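(* Let $a_n = \sinh\left(\frac{1}{n+2}\right)$ for all integers $n\ge 0$. Then the terraced matrix $M=M(a)$ generated by the sequence $a=\{a_n\}_{n\ge 0}$ is a hyponormal operator on $\ell^2$.
   Context: $\ell^2$ denotes the Hilbert space of square-summable complex sequences indexed by the nonnegative integers. For a sequence $a=\{a_n\}_{n\ge 0}$ of complex numbers, the terraced matrix $M(a)$ generated by $a$ is the lower triangular infinite matrix with constant row segments, i.e. the matrix with entries $m_{nj}=a_n$ for $0\le j\le n$ and $m_{nj}=0$ for $j>n$ ($n,j\ge 0$); it acts on $\ell^2$ by matrix multiplication, $(Mf)_n = a_n\sum_{j=0}^n f_j$. A bounded linear operator $M$ on $\ell^2$ is hyponormal if $\langle (M^*M-MM^* )f,f\rangle\ge 0$ for all $f\in\ell^2$. Saying that a terraced matrix is a hyponormal operator on $\ell^2$ means that it acts as a bounded linear operator on $\ell^2$ and this operator is hyponormal. *)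

theory Defs
  imports "HOL-Analysis.Analysis" "HOL-Library.Complex_Order"
begin

definition ell2 :: "(nat \<Rightarrow> complex) set" where
  "ell2 = {f. summable (\<lambda>n. (cmod (f n))\<^sup>2)}"

definition ell2_inner :: "(nat \<Rightarrow> complex) \<Rightarrow> (nat \<Rightarrow> complex) \<Rightarrow> complex" where
  "ell2_inner f g = (\<Sum>n. f n * cnj (g n))"

definition ell2_norm :: "(nat \<Rightarrow> complex) \<Rightarrow> real" where
  "ell2_norm f = sqrt (\<Sum>n. (cmod (f n))\<^sup>2)"

text \<open>Operators are functions on all sequences, of which only the behaviour on \<^const>\<open>ell2\<close> matters.\<close>

definition bounded_operator_ell2 :: "((nat \<Rightarrow> complex) \<Rightarrow> (nat \<Rightarrow> complex)) \<Rightarrow> bool" where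
  "bounded_operator_ell2 T \<longleftrightarrow>
     (\<forall>f\<in>ell2. T f \<in> ell2) \<and>
     (\<forall>f\<in>ell2. \<forall>g\<in>ell2. T (\<lambda>n. f n + g n) = (\<lambda>n. T f n + T g n)) \<and>
     (\<forall>c. \<forall>f\<in>ell2. T (\<lambda>n. c * f n) = (\<lambda>n. c * T f n)) \<and>
     (\<exists>K. \<forall>f\<in>ell2. ell2_norm (T f) \<le> K * ell2_norm f)"

text \<open>For \<open>g\<close> in \<^const>\<open>ell2\<close> and \<open>T\<close> bounded, the description below is satisfied by exactly one
  vector, by the Riesz representation theorem; in other cases the value is irrelevant.\<close>

definition ell2_adjoint ::
    "((nat \<Rightarrow> complex) \<Rightarrow> (nat \<Rightarrow> complex)) \<Rightarrow> (nat \<Rightarrow> complex) \<Rightarrow> (nat \<Rightarrow> complex)" where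
  "ell2_adjoint T g = (THE h. h \<in> ell2 \<and> (\<forall>f\<in>ell2. ell2_inner (T f) g = ell2_inner f h))"

text \<open>The order on \<^typ>\<open>complex\<close> is the one of \<^theory>\<open>HOL-Library.Complex_Order\<close>: \<open>0 \<le> z\<close> means
  that \<open>z\<close> is real and nonnegative.\<close>

definition hyponormal_ell2 :: "((nat \<Rightarrow> complex) \<Rightarrow> (nat \<Rightarrow> complex)) \<Rightarrow> bool" where
  "hyponormal_ell2 T \<longleftrightarrow>
     bounded_operator_ell2 T \<and>
     (\<forall>f\<in>ell2. 0 \<le> ell2_inner (\<lambda>n. ell2_adjoint T (T f) n - T (ell2_adjoint T f) n) f)"

definition terraced_matrix :: "(nat \<Rightarrow> complex) \<Rightarrow> nat \<Rightarrow> nat \<Rightarrow> complex" where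
  "terraced_matrix a n j = (if j \<le> n then a n else 0)"

text \<open>The series in a row of a terraced matrix has only finitely many nonzero terms, so its
  convergence is not an issue.\<close>

definition matrix_action :: "(nat \<Rightarrow> nat \<Rightarrow> complex) \<Rightarrow> (nat \<Rightarrow> complex) \<Rightarrow> (nat \<Rightarrow> complex)" where
  "matrix_action m f n = (\<Sum>j. m n j * f j)"

lemma matrix_action_terraced: "matrix_action (terraced_matrix a) f n = a n * (\<Sum>j\<le>n. f j)"
proof -
  have "(\<Sum>j. terraced_matrix a n j * f j) = (\<Sum>j\<le>n. terraced_matrix a n j * f j)"
    by (rule suminf_finite) (auto simp: terraced_matrix_def)
  then show ?thesis
    by (simp add: matrix_action_def terraced_matrix_def sum_distrib_left)
qed

end

theory Submission
  imports Defs
begin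

text \<open>
  Let \<open>a\<close> be a positive sequence with \<open>(n + 1) a\<^sub>n\<close> bounded and \<open>a\<^sub>0 \<le> 2 a\<^sub>1\<close> whose
  reciprocals \<open>1 / a\<^sub>n\<close> form a concave sequence. Then the terraced matrix \<open>M\<close> generated by \<open>a\<close> is
  hyponormal (\<open>hyponormal_M\<close> below), and \<open>a\<^sub>n = sinh (1 / (n + 2))\<close> is such a sequence because
  \<open>x \<mapsto> 1 / sinh (1 / x)\<close> is concave on \<open>[2, \<infinity>)\<close>.

  Boundedness of \<open>M\<close> is Hardy's inequality. The adjoint is \<open>(M\<^sup>* f)\<^sub>j = \<Sum>\<^sub>n\<^sub>\<ge>\<^sub>j a\<^sub>n f\<^sub>n\<close>, which maps
  \<open>\<ell>\<^sup>2\<close> to itself by the dual of Hardy's inequality, and hyponormality says that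
  \<open>\<parallel>M\<^sup>* f\<parallel> \<le> \<parallel>M f\<parallel>\<close> for all \<open>f\<close>.

  To compare the two norms, put \<open>y = M f\<close>, \<open>h = M\<^sup>* f\<close>, \<open>T\<^sub>k = h\<^sub>k\<^sub>+\<^sub>1 + y\<^sub>k\<close> and
  \<open>w\<^sub>k = a\<^sub>k / (a\<^sub>k - a\<^sub>k\<^sub>+\<^sub>1)\<close>. Both vectors are recovered from the single sequence \<open>T\<close>: one has
  \<open>y\<^sub>k = w\<^sub>k (T\<^sub>k - T\<^sub>k\<^sub>+\<^sub>1)\<close>, \<open>h\<^sub>k\<^sub>+\<^sub>1 = T\<^sub>k - y\<^sub>k\<close> and \<open>h\<^sub>0 = T\<^sub>0\<close>. Expanding the squares gives
  \[ |y_k|^2 - |h_{k+1}|^2 = w_k (|T_k|^2 - |T_{k+1}|^2) - |T_k|^2 + |y_k|^2 / w_k . \]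
  Summation by parts turns \<open>\<parallel>y\<parallel>\<^sup>2 - \<parallel>h\<parallel>\<^sup>2\<close> into a sum of nonnegative terms as soon as
  \<open>w\<^sub>0 \<ge> 2\<close> and \<open>w\<^sub>k\<^sub>+\<^sub>1 \<ge> w\<^sub>k + 1\<close>. The first condition is \<open>a\<^sub>0 \<le> 2 a\<^sub>1\<close>, and the second one, after
  clearing denominators, is exactly the concavity of \<open>1 / a\<close>.

  Cutting the sum off at \<open>N\<close> leaves the boundary term \<open>w\<^sub>N |T\<^sub>N\<^sub>+\<^sub>1|\<^sup>2\<close>. Here \<open>w\<^sub>N\<close> grows at most
  linearly while \<open>|T\<^sub>N\<^sub>+\<^sub>1|\<^sup>2\<close> is summable, so the boundary term has lower limit \<open>0\<close>: otherwise
  the harmonic series would converge.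
\<close>

section \<open>Hardy's inequality and its dual\<close>

text \<open>
  The classical telescoping proof: the averages \<open>y\<^sub>n\<close> of \<open>f\<close> satisfy
  \<open>y\<^sub>n\<^sup>2 - 2 f\<^sub>n y\<^sub>n \<le> n y\<^sub>n\<^sub>-\<^sub>1\<^sup>2 - (n + 1) y\<^sub>n\<^sup>2\<close>, so these differences have nonpositive partial sums,
  and \<open>2 f\<^sub>n y\<^sub>n\<close> can be absorbed into \<open>f\<^sub>n\<^sup>2\<close> and \<open>y\<^sub>n\<^sup>2\<close>.
\<close>
lemma hardy_finite:
  fixes f :: "nat \<Rightarrow> real"
  shows "(\<Sum>n\<le>N. ((\<Sum>j\<le>n. f j) / real (n + 1))\<^sup>2) \<le> 4 * (\<Sum>n\<le>N. (f n)\<^sup>2)"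
proof -
  define y where "y n = (\<Sum>j\<le>n. f j) / real (n + 1)" for n
  have f_Suc: "f (Suc n) = (real n + 2) * y (Suc n) - (real n + 1) * y n" for n
  proof -
    have "(\<Sum>j\<le>m. f j) = (real m + 1) * y m" for m
      by (simp add: y_def field_simps)
    from this[of n] this[of "Suc n"] show ?thesis by (simp add: algebra_simps)
  qed
  have telescoped: "(\<Sum>n\<le>N. (y n)\<^sup>2 - 2 * f n * y n) \<le> - (real (N + 1) * (y N)\<^sup>2)"
  proof (induction N)
    case 0
    then show ?case by (simp add: y_def power2_eq_square)
  next
    case (Suc N)
    have "0 \<le> (real N + 1) * (y (Suc N) - y N)\<^sup>2"
      by simp
    with Suc show ?case
      unfolding sum.atMost_Suc f_Suc by (simp add: algebra_simps power2_eq_square)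
  qed
  have "(y n)\<^sup>2 \<le> 4 * (f n)\<^sup>2 + 2 * ((y n)\<^sup>2 - 2 * f n * y n)" for n
    using zero_le_power2[of "2 * f n - y n"] by (simp add: algebra_simps power2_eq_square)
  then have "(\<Sum>n\<le>N. (y n)\<^sup>2) \<le> (\<Sum>n\<le>N. 4 * (f n)\<^sup>2 + 2 * ((y n)\<^sup>2 - 2 * f n * y n))"
    by (intro sum_mono)
  also have "\<dots> = 4 * (\<Sum>n\<le>N. (f n)\<^sup>2) + 2 * (\<Sum>n\<le>N. (y n)\<^sup>2 - 2 * f n * y n)"
    by (simp add: sum.distrib sum_distrib_left)
  also have "\<dots> \<le> 4 * (\<Sum>n\<le>N. (f n)\<^sup>2)"
    using telescoped order_trans[of _ "- (real (N + 1) * (y N)\<^sup>2)" 0] by simp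
  finally show ?thesis by (simp add: y_def)
qed

lemma sum_eq_weighted_differences:
  fixes x :: "nat \<Rightarrow> real"
  shows "(\<Sum>n\<le>L. x n) = (\<Sum>n\<le>L. real (n + 1) * (x n - x (Suc n))) + real (L + 1) * x (Suc L)"
  by (induction L) (simp_all add: algebra_simps)

text \<open>
  Summation by parts replaces \<open>H\<^sub>n\<^sup>2\<close> by \<open>(n + 1) (H\<^sub>n\<^sup>2 - H\<^sub>n\<^sub>+\<^sub>1\<^sup>2) \<le> 2 (n + 1) b\<^sub>n H\<^sub>n\<close>, and half of
  \<open>H\<^sub>n\<^sup>2\<close> is absorbed back. Because the tails \<open>H\<^sub>n\<close> are cut off at \<open>L\<close>, there is no boundary term;
  the bound does not depend on \<open>L\<close>, which is what makes the passage to full tails possible.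
\<close>
lemma hardy_dual_finite:
  fixes b :: "nat \<Rightarrow> real"
  assumes "\<And>n. 0 \<le> b n"
  shows "(\<Sum>n\<le>L. (\<Sum>k=n..L. b k)\<^sup>2) \<le> 4 * (\<Sum>n\<le>L. (real (n + 1) * b n)\<^sup>2)"
proof -
  define H where "H n = (\<Sum>k=n..L. b k)" for n
  have H_step: "H n = b n + H (Suc n)" if "n \<le> L" for n
    unfolding H_def using that by (rule sum.atLeast_Suc_atMost)
  have "(\<Sum>n\<le>L. (H n)\<^sup>2) = (\<Sum>n\<le>L. real (n + 1) * ((H n)\<^sup>2 - (H (Suc n))\<^sup>2))"
    using sum_eq_weighted_differences[of "\<lambda>n. (H n)\<^sup>2" L] by (simp add: H_def)
  also have "\<dots> \<le> (\<Sum>n\<le>L. 2 * (real (n + 1) * b n)\<^sup>2 + (H n)\<^sup>2 / 2)"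
  proof (rule sum_mono)
    fix n assume "n \<in> {..L}"
    then have step: "H (Suc n) = H n - b n"
      using H_step[of n] by simp
    have "(H n)\<^sup>2 - (H (Suc n))\<^sup>2 \<le> 2 * b n * H n"
      unfolding step by (simp add: algebra_simps power2_eq_square)
    then have "real (n + 1) * ((H n)\<^sup>2 - (H (Suc n))\<^sup>2) \<le> real (n + 1) * (2 * b n * H n)"
      by (intro mult_left_mono) auto
    also have "\<dots> \<le> 2 * (real (n + 1) * b n)\<^sup>2 + (H n)\<^sup>2 / 2"
      using sum_squares_bound[of "2 * (real (n + 1) * b n)" "H n"]
      unfolding power_mult_distrib[of 2] by (simp add: mult.assoc)
    finally show "real (n + 1) * ((H n)\<^sup>2 - (H (Suc n))\<^sup>2)
        \<le> 2 * (real (n + 1) * b n)\<^sup>2 + (H n)\<^sup>2 / 2" .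
  qed
  also have "\<dots> = 2 * (\<Sum>n\<le>L. (real (n + 1) * b n)\<^sup>2) + (\<Sum>n\<le>L. (H n)\<^sup>2) / 2"
    by (simp add: sum.distrib sum_distrib_left sum_divide_distrib)
  finally show ?thesis by (simp add: H_def)
qed

lemma hardy_dual:
  fixes b :: "nat \<Rightarrow> real"
  assumes nonneg: "\<And>n. 0 \<le> b n" and sq: "summable (\<lambda>n. (real (n + 1) * b n)\<^sup>2)"
  shows "summable b" and "summable (\<lambda>n. (\<Sum>k. b (k + n))\<^sup>2)"
proof -
  define B where "B = 4 * (\<Sum>n. (real (n + 1) * b n)\<^sup>2)"
  have segment: "(\<Sum>n\<le>N. (\<Sum>k=n..L. b k)\<^sup>2) \<le> B" if "N \<le> L" for N L
  proof -
    have "(\<Sum>n\<le>N. (\<Sum>k=n..L. b k)\<^sup>2) \<le> (\<Sum>n\<le>L. (\<Sum>k=n..L. b k)\<^sup>2)"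
      using that by (intro sum_mono2) auto
    also have "\<dots> \<le> 4 * (\<Sum>n\<le>L. (real (n + 1) * b n)\<^sup>2)"
      using nonneg by (rule hardy_dual_finite)
    also have "\<dots> \<le> B"
      unfolding B_def using sum_le_suminf[OF sq, of "{..L}"] by simp
    finally show ?thesis .
  qed
  have "(\<Sum>k\<le>L. b k) \<le> sqrt B" for L
    using segment[of 0 L] by (intro real_le_rsqrt) (simp add: atLeast0AtMost)
  then show summable_b: "summable b"
    using nonneg by (intro bounded_imp_summable)
  have limit: "(\<lambda>L. \<Sum>k=n..L. b k) \<longlonglongrightarrow> (\<Sum>k. b (k + n))" for n
  proof (rule Lim_transform_eventually)
    have "(\<lambda>L. \<Sum>k<Suc L. b k) \<longlonglongrightarrow> suminf b"
      using summable_LIMSEQ[OF summable_b] by (rule LIMSEQ_Suc)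
    then show "(\<lambda>L. (\<Sum>k<Suc L. b k) - (\<Sum>k<n. b k)) \<longlonglongrightarrow> (\<Sum>k. b (k + n))"
      unfolding suminf_minus_initial_segment[OF summable_b] by (intro tendsto_intros)
    show "\<forall>\<^sub>F L in sequentially. (\<Sum>k<Suc L. b k) - (\<Sum>k<n. b k) = (\<Sum>k=n..L. b k)"
    proof (rule eventually_mono[OF eventually_ge_at_top[of n]])
      fix L assume "n \<le> L"
      then have "(\<Sum>k<Suc L. b k) = (\<Sum>k<n. b k) + (\<Sum>k=n..<Suc L. b k)"
        using sum.atLeastLessThan_concat[of 0 n "Suc L" b] by (simp add: atLeast0LessThan)
      then show "(\<Sum>k<Suc L. b k) - (\<Sum>k<n. b k) = (\<Sum>k=n..L. b k)"
        by (simp add: atLeastLessThanSuc_atLeastAtMost)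
    qed
  qed
  have "(\<Sum>n\<le>N. (\<Sum>k. b (k + n))\<^sup>2) \<le> B" for N
  proof (rule LIMSEQ_le_const2)
    show "(\<lambda>L. \<Sum>n\<le>N. (\<Sum>k=n..L. b k)\<^sup>2) \<longlonglongrightarrow> (\<Sum>n\<le>N. (\<Sum>k. b (k + n))\<^sup>2)"
      by (intro tendsto_intros limit)
  qed (use segment in auto)
  then show "summable (\<lambda>n. (\<Sum>k. b (k + n))\<^sup>2)"
    by (intro bounded_imp_summable) auto
qed

section \<open>Boundary terms along a summable sequence\<close>

text \<open>
  The divergence of the harmonic series in the form in which it disposes of boundary terms:
  if \<open>\<Sum> x\<^sub>n\<close> converges, then \<open>(n + 1) x\<^sub>n\<close> cannot stay above a positive constant.
\<close>
lemma limit_nonneg_of_summable_bound: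
  fixes X x :: "nat \<Rightarrow> real"
  assumes "X \<longlonglongrightarrow> l" and "summable x"
    and lower: "\<And>n. - (real (n + 1) * x n) \<le> X n"
  shows "0 \<le> l"
proof (rule ccontr)
  assume "\<not> 0 \<le> l"
  then have "l < l / 2" by simp
  with \<open>X \<longlonglongrightarrow> l\<close> have "\<forall>\<^sub>F n in sequentially. X n < l / 2"
    by (rule order_tendstoD)
  then have "\<forall>\<^sub>F n in sequentially. norm (inverse (real (Suc n))) \<le> x n / (- l / 2)"
  proof (rule eventually_mono)
    fix n assume "X n < l / 2"
    with lower[of n] have "- l / 2 \<le> real (n + 1) * x n" by linarith
    with \<open>\<not> 0 \<le> l\<close> show "norm (inverse (real (Suc n))) \<le> x n / (- l / 2)"
      by (simp add: field_simps)
  qed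
  then have "summable (\<lambda>n. inverse (real (Suc n)))"
    by (rule summable_comparison_test_ev) (intro summable_divide \<open>summable x\<close>)
  then show False
    using not_summable_harmonic[where 'a = real] summable_Suc_iff[of "\<lambda>n. inverse (real n)"] by simp
qed

lemma limit_zero_of_summable_bound:
  fixes X :: "nat \<Rightarrow> 'a::real_normed_vector"
  assumes "X \<longlonglongrightarrow> l" and "summable x" and "\<And>n. norm (X n) \<le> real (n + 1) * x n"
  shows "l = 0"
proof -
  have "(\<lambda>n. - norm (X n)) \<longlonglongrightarrow> - norm l"
    using assms(1) by (intro tendsto_intros)
  then have "0 \<le> - norm l"
    using assms(2) by (rule limit_nonneg_of_summable_bound) (use assms(3) in simp)
  then show ?thesis by simp
qed

section \<open>The inner product of square-summable sequences\<close>

lemma ell2_summable_inner: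
  assumes "f \<in> ell2" "g \<in> ell2"
  shows "summable (\<lambda>n. f n * cnj (g n))"
proof (rule summable_comparison_test')
  show "summable (\<lambda>n. ((cmod (f n))\<^sup>2 + (cmod (g n))\<^sup>2) / 2)"
    using assms unfolding ell2_def by (intro summable_divide summable_add) auto
  show "norm (f n * cnj (g n)) \<le> ((cmod (f n))\<^sup>2 + (cmod (g n))\<^sup>2) / 2" if "0 \<le> n" for n
    using sum_squares_bound[of "cmod (f n)" "cmod (g n)"] by (simp add: norm_mult)
qed

lemma ell2_inner_diff_left:
  assumes "f \<in> ell2" "g \<in> ell2" "h \<in> ell2"
  shows "ell2_inner (\<lambda>n. f n - g n) h = ell2_inner f h - ell2_inner g h"
  unfolding ell2_inner_def left_diff_distrib
  using assms by (intro suminf_diff[symmetric] ell2_summable_inner)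

lemma ell2_inner_commute:
  assumes "f \<in> ell2" "g \<in> ell2"
  shows "ell2_inner g f = cnj (ell2_inner f g)"
proof -
  have "(\<lambda>n. cnj (f n * cnj (g n))) sums cnj (ell2_inner f g)"
    unfolding ell2_inner_def sums_cnj
    using ell2_summable_inner[OF assms] by (rule summable_sums)
  then show ?thesis
    unfolding ell2_inner_def[of g f] by (intro sums_unique[symmetric]) (simp add: mult.commute)
qed

lemma ell2_inner_self:
  assumes "f \<in> ell2"
  shows "ell2_inner f f = complex_of_real (\<Sum>n. (cmod (f n))\<^sup>2)"
  using assms unfolding ell2_inner_def ell2_def mem_Collect_eq complex_norm_square[symmetric]
  by (rule suminf_of_real[symmetric])

text \<open>Testing against the unit vectors recovers the entries; this makes the adjoint unique.\<close>
lemma ell2_eqI: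
  assumes "\<And>f. f \<in> ell2 \<Longrightarrow> ell2_inner f g = ell2_inner f h"
  shows "g = h"
proof
  fix k
  define e where "e n = (if n = k then 1 else 0 :: complex)" for n :: nat
  have "e \<in> ell2"
    unfolding ell2_def using summable_finite[of "{k}" "\<lambda>n. (cmod (e n))\<^sup>2"] by (simp add: e_def)
  moreover have "ell2_inner e u = cnj (u k)" for u
    unfolding ell2_inner_def by (subst suminf_finite[of "{k}"]) (auto simp: e_def)
  ultimately have "cnj (g k) = cnj (h k)"
    using assms by metis
  then show "g k = h k" by simp
qed

lemma ell2_adjoint_eqI:
  assumes "h \<in> ell2" "\<And>f. f \<in> ell2 \<Longrightarrow> ell2_inner (T f) g = ell2_inner f h"
  shows "ell2_adjoint T g = h"
  unfolding ell2_adjoint_def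
proof (rule the_equality)
  fix h' assume "h' \<in> ell2 \<and> (\<forall>f\<in>ell2. ell2_inner (T f) g = ell2_inner f h')"
  with assms(2) show "h' = h"
    by (intro ell2_eqI) metis
qed (use assms in auto)

section \<open>Bounded terraced operators and their adjoints\<close>

locale bounded_terraced =
  fixes a :: "nat \<Rightarrow> real" and C :: real
  assumes nonneg: "\<And>n. 0 \<le> a n"
    and decay: "\<And>n. real (n + 1) * a n \<le> C"
begin

definition M :: "(nat \<Rightarrow> complex) \<Rightarrow> nat \<Rightarrow> complex" where
  "M f n = of_real (a n) * (\<Sum>j\<le>n. f j)"

definition M_adj :: "(nat \<Rightarrow> complex) \<Rightarrow> nat \<Rightarrow> complex" where
  "M_adj g j = (\<Sum>k. of_real (a (k + j)) * g (k + j))"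

lemma C_nonneg: "0 \<le> C"
  using decay[of 0] nonneg[of 0] by simp

lemma sum_cmod_M_le:
  "(\<Sum>n\<le>N. (cmod (M f n))\<^sup>2) \<le> 4 * C\<^sup>2 * (\<Sum>n\<le>N. (cmod (f n))\<^sup>2)"
proof -
  have "(cmod (M f n))\<^sup>2 \<le> C\<^sup>2 * ((\<Sum>j\<le>n. cmod (f j)) / real (n + 1))\<^sup>2" for n
  proof -
    have "cmod (M f n) \<le> a n * (\<Sum>j\<le>n. cmod (f j))"
      unfolding M_def norm_mult using nonneg by (simp add: mult_left_mono norm_sum)
    also have "a n \<le> C / real (n + 1)"
      using decay[of n] by (simp add: field_simps)
    finally have "cmod (M f n) \<le> C * ((\<Sum>j\<le>n. cmod (f j)) / real (n + 1))"
      by (simp add: mult_right_mono sum_nonneg)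
    then show ?thesis
      unfolding power_mult_distrib[symmetric] by (intro power_mono) auto
  qed
  then have "(\<Sum>n\<le>N. (cmod (M f n))\<^sup>2)
      \<le> C\<^sup>2 * (\<Sum>n\<le>N. ((\<Sum>j\<le>n. cmod (f j)) / real (n + 1))\<^sup>2)"
    unfolding sum_distrib_left by (intro sum_mono)
  also have "\<dots> \<le> C\<^sup>2 * (4 * (\<Sum>n\<le>N. (cmod (f n))\<^sup>2))"
    by (intro mult_left_mono hardy_finite) auto
  finally show ?thesis by simp
qed

lemma sum_cmod_M_le_suminf:
  assumes "f \<in> ell2"
  shows "(\<Sum>n\<le>N. (cmod (M f n))\<^sup>2) \<le> 4 * C\<^sup>2 * (\<Sum>n. (cmod (f n))\<^sup>2)"
proof -
  have "(\<Sum>n\<le>N. (cmod (f n))\<^sup>2) \<le> (\<Sum>n. (cmod (f n))\<^sup>2)"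
    using assms unfolding ell2_def by (intro sum_le_suminf) auto
  then have "4 * C\<^sup>2 * (\<Sum>n\<le>N. (cmod (f n))\<^sup>2) \<le> 4 * C\<^sup>2 * (\<Sum>n. (cmod (f n))\<^sup>2)"
    by (rule mult_left_mono) simp
  with sum_cmod_M_le show ?thesis
    by (rule order_trans)
qed

lemma M_ell2: "f \<in> ell2 \<Longrightarrow> M f \<in> ell2"
  unfolding ell2_def[THEN eqset_imp_iff, of "M f"] mem_Collect_eq
  by (rule bounded_imp_summable[OF _ sum_cmod_M_le_suminf]) auto

lemma bounded_operator_M: "bounded_operator_ell2 M"
  unfolding bounded_operator_ell2_def
proof (intro conjI exI ballI allI)
  fix f assume f: "f \<in> ell2"
  then show "M f \<in> ell2" by (rule M_ell2)
  then have "summable (\<lambda>n. (cmod (M f n))\<^sup>2)"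
    by (simp add: ell2_def)
  then have "(\<Sum>n. (cmod (M f n))\<^sup>2) \<le> (2 * C)\<^sup>2 * (\<Sum>n. (cmod (f n))\<^sup>2)"
    using sum_cmod_M_le_suminf[OF f]
    by (intro LIMSEQ_le_const2[OF summable_LIMSEQ']) (simp_all add: power_mult_distrib)
  then have "sqrt (\<Sum>n. (cmod (M f n))\<^sup>2) \<le> sqrt ((2 * C)\<^sup>2 * (\<Sum>n. (cmod (f n))\<^sup>2))"
    by (rule real_sqrt_le_mono)
  then show "ell2_norm (M f) \<le> (2 * C) * ell2_norm f"
    using C_nonneg by (simp add: ell2_norm_def real_sqrt_mult)
qed (auto simp: M_def fun_eq_iff sum.distrib algebra_simps sum_distrib_left)

context
  fixes g :: "nat \<Rightarrow> complex"
  assumes g: "g \<in> ell2"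
begin

lemma summable_weighted_cmod: "summable (\<lambda>k. a k * cmod (g k))"
  and summable_tails_sq: "summable (\<lambda>n. (\<Sum>k. a (k + n) * cmod (g (k + n)))\<^sup>2)"
proof -
  have sq: "summable (\<lambda>n. (real (n + 1) * (a n * cmod (g n)))\<^sup>2)"
  proof (rule summable_comparison_test')
    show "summable (\<lambda>n. C\<^sup>2 * (cmod (g n))\<^sup>2)"
      using g unfolding ell2_def by (intro summable_mult) simp
    show "norm ((real (n + 1) * (a n * cmod (g n)))\<^sup>2) \<le> C\<^sup>2 * (cmod (g n))\<^sup>2" if "0 \<le> n" for n
    proof -
      have "real (n + 1) * (a n * cmod (g n)) \<le> C * cmod (g n)"
        unfolding mult.assoc[symmetric] by (intro mult_right_mono decay) auto
      then show ?thesis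
        unfolding power_mult_distrib[symmetric] real_norm_def abs_power2
        by (intro power_mono) (use nonneg in auto)
    qed
  qed
  show "summable (\<lambda>k. a k * cmod (g k))"
    by (rule hardy_dual(1)[OF _ sq]) (simp add: nonneg)
  show "summable (\<lambda>n. (\<Sum>k. a (k + n) * cmod (g (k + n)))\<^sup>2)"
    by (rule hardy_dual(2)[OF _ sq]) (simp add: nonneg)
qed

lemma summable_weighted: "summable (\<lambda>k. of_real (a k) * g k)"
  by (rule summable_norm_cancel) (use summable_weighted_cmod nonneg in \<open>simp add: norm_mult\<close>)

lemma M_adj_ell2: "M_adj g \<in> ell2"
proof -
  have "cmod (M_adj g n) \<le> (\<Sum>k. a (k + n) * cmod (g (k + n)))" for n
  proof -
    have "summable (\<lambda>k. norm (of_real (a (k + n)) * g (k + n)))"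
      using summable_ignore_initial_segment[OF summable_weighted_cmod, of n] nonneg
      by (simp add: norm_mult)
    from summable_norm[OF this] show ?thesis
      unfolding M_adj_def using nonneg by (simp add: norm_mult)
  qed
  then have "norm ((cmod (M_adj g n))\<^sup>2) \<le> (\<Sum>k. a (k + n) * cmod (g (k + n)))\<^sup>2" for n
    by (simp add: power_mono)
  then show ?thesis
    unfolding ell2_def mem_Collect_eq
    by (intro summable_comparison_test'[OF summable_tails_sq])
qed

lemma M_adj_step: "M_adj g j = of_real (a j) * g j + M_adj g (Suc j)"
  using suminf_split_head[OF summable_ignore_initial_segment[OF summable_weighted, of j]]
  by (simp add: M_adj_def)

text \<open>
  By summation by parts, the partial sums of the two inner products differ by
  \<open>(f\<^sub>0 + \<dots> + f\<^sub>N) (M\<^sup>* g)\<^sub>N\<^sub>+\<^sub>1\<close> up to conjugation. The first factor is \<open>N + 1\<close> times an entry of the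
  image of \<open>f\<close> under the Cesaro operator, which is itself a bounded terraced operator; so the
  difference is at most \<open>N + 1\<close> times the general term of a convergent series.
\<close>
lemma inner_M_eq:
  assumes f: "f \<in> ell2"
  shows "ell2_inner (M f) g = ell2_inner f (M_adj g)"
proof -
  have partial: "(\<Sum>n\<le>N. f n * cnj (M_adj g n)) - (\<Sum>n\<le>N. M f n * cnj (g n))
      = (\<Sum>j\<le>N. f j) * cnj (M_adj g (Suc N))" for N
  proof (induction N)
    case 0
    then show ?case
      by (subst M_adj_step) (simp add: M_def algebra_simps)
  next
    case (Suc N)
    have "cnj (M_adj g (Suc N))
        = of_real (a (Suc N)) * cnj (g (Suc N)) + cnj (M_adj g (Suc (Suc N)))"
      by (subst M_adj_step) simp
    with Suc show ?case
      by (simp add: M_def algebra_simps)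
  qed
  have "(\<lambda>N. \<Sum>n\<le>N. u n * cnj (v n)) \<longlonglongrightarrow> ell2_inner u v"
    if "u \<in> ell2" "v \<in> ell2" for u v
    unfolding ell2_inner_def using ell2_summable_inner[OF that] by (rule summable_LIMSEQ')
  then have limit: "(\<lambda>N. (\<Sum>j\<le>N. f j) * cnj (M_adj g (Suc N)))
      \<longlonglongrightarrow> ell2_inner f (M_adj g) - ell2_inner (M f) g"
    unfolding partial[symmetric]
    by (intro tendsto_diff) (use f g M_ell2 M_adj_ell2 in auto)
  interpret cesaro: bounded_terraced "\<lambda>n. 1 / real (n + 1)" 1
    by unfold_locales auto
  have "summable (\<lambda>n. (cmod (cesaro.M f n))\<^sup>2 + (cmod (M_adj g (Suc n)))\<^sup>2)"
    using cesaro.M_ell2[OF f] M_adj_ell2 unfolding ell2_def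
    by (intro summable_add) (auto simp: summable_Suc_iff[of "\<lambda>n. (cmod (M_adj g n))\<^sup>2"])
  moreover have "norm ((\<Sum>j\<le>N. f j) * cnj (M_adj g (Suc N)))
      \<le> real (N + 1) * ((cmod (cesaro.M f N))\<^sup>2 + (cmod (M_adj g (Suc N)))\<^sup>2)" for N
  proof -
    have "(\<Sum>j\<le>N. f j) = of_real (real (N + 1)) * cesaro.M f N"
      unfolding cesaro.M_def mult.assoc[symmetric] of_real_mult[symmetric] by simp
    then have "norm ((\<Sum>j\<le>N. f j) * cnj (M_adj g (Suc N)))
        = real (N + 1) * (cmod (cesaro.M f N) * cmod (M_adj g (Suc N)))"
      by (simp only: norm_mult norm_of_real complex_mod_cnj mult.assoc abs_of_nat)
    also have "cmod (cesaro.M f N) * cmod (M_adj g (Suc N))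
        \<le> (cmod (cesaro.M f N))\<^sup>2 + (cmod (M_adj g (Suc N)))\<^sup>2"
      using sum_squares_bound[of "cmod (cesaro.M f N)" "cmod (M_adj g (Suc N))"]
        mult_nonneg_nonneg[OF norm_ge_zero norm_ge_zero, of "cesaro.M f N" "M_adj g (Suc N)"]
      by linarith
    finally show ?thesis by (simp add: mult_left_mono)
  qed
  ultimately have "ell2_inner f (M_adj g) - ell2_inner (M f) g = 0"
    using limit_zero_of_summable_bound[OF limit] by blast
  then show ?thesis by simp
qed

lemma adjoint_M: "ell2_adjoint M g = M_adj g"
  by (rule ell2_adjoint_eqI[OF M_adj_ell2 inner_M_eq])

end

text \<open>
  Moving \<open>M\<close> and its adjoint to the other argument turns
  \<open>\<langle>(M\<^sup>* M - M M\<^sup>*) f, f\<rangle>\<close> into \<open>\<parallel>M f\<parallel>\<^sup>2 - \<parallel>M\<^sup>* f\<parallel>\<^sup>2\<close>.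
\<close>
lemma hyponormal_M_I:
  assumes "\<And>f. f \<in> ell2 \<Longrightarrow> (\<Sum>n. (cmod (M_adj f n))\<^sup>2) \<le> (\<Sum>n. (cmod (M f n))\<^sup>2)"
  shows "hyponormal_ell2 M"
  unfolding hyponormal_ell2_def
proof (intro conjI ballI bounded_operator_M)
  fix f assume f: "f \<in> ell2"
  note mem = f M_ell2[OF f] M_adj_ell2[OF f] M_adj_ell2[OF M_ell2[OF f]] M_ell2[OF M_adj_ell2[OF f]]
  have "ell2_inner (\<lambda>n. M_adj (M f) n - M (M_adj f) n) f
      = cnj (ell2_inner f (M_adj (M f))) - ell2_inner (M (M_adj f)) f"
    using mem by (simp add: ell2_inner_diff_left ell2_inner_commute[of f "M_adj (M f)"])
  also have "\<dots> = cnj (ell2_inner (M f) (M f)) - ell2_inner (M_adj f) (M_adj f)"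
    using mem by (simp add: inner_M_eq)
  also have "\<dots> = of_real ((\<Sum>n. (cmod (M f n))\<^sup>2) - (\<Sum>n. (cmod (M_adj f n))\<^sup>2))"
    using mem by (simp add: ell2_inner_self)
  finally show "0 \<le> ell2_inner (\<lambda>n. ell2_adjoint M (M f) n - M (ell2_adjoint M f) n) f"
    using assms[OF f] mem by (simp add: adjoint_M less_eq_complex_def)
qed

end

section \<open>Terraced matrices with concave reciprocals\<close>

locale concave_terraced = bounded_terraced +
  assumes pos: "\<And>n. 0 < a n"
    and concave: "\<And>n. 1 / a n + 1 / a (n + 2) \<le> 2 / a (n + 1)"
    and initial: "a 0 \<le> 2 * a 1"
begin

text \<open>The factors \<open>w\<^sub>n\<close> of the summation by parts that compares the two norms.\<close>

definition gap_ratio :: "nat \<Rightarrow> real" where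
  "gap_ratio n = a n / (a n - a (Suc n))"

lemma C_pos: "0 < C"
  using decay[of 0] pos[of 0] by simp

lemma reciprocal_le_linear:
  "1 / a (m + k) \<le> 1 / a m + real k * (1 / a (Suc m) - 1 / a m)"
proof -
  define \<delta> where "\<delta> n = 1 / a (Suc n) - 1 / a n" for n
  have "\<delta> (Suc n) \<le> \<delta> n" for n
    using concave[of n] by (simp add: \<delta>_def)
  then have anti: "\<delta> (m + k) \<le> \<delta> m" for k
    by (induction k) (auto intro: order_trans)
  have "1 / a (m + k) \<le> 1 / a m + real k * \<delta> m"
  proof (induction k)
    case (Suc k)
    then show ?case
      using anti[of k] by (simp add: \<delta>_def[of "m + k"] distrib_right)
  qed simp
  then show ?thesis by (simp add: \<delta>_def)
qed

text \<open>
  The increments of \<open>1 / a\<close> decrease, and \<open>1 / a\<^sub>n \<ge> (n + 1) / C\<close>. If some increment were below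
  \<open>1 / C\<close>, the reciprocals would eventually fall below this line.
\<close>
lemma reciprocal_increment_ge: "1 / C \<le> 1 / a (Suc m) - 1 / a m"
proof (rule ccontr)
  define \<delta> where "\<delta> = 1 / a (Suc m) - 1 / a m"
  assume "\<not> ?thesis"
  then have "\<delta> < 1 / C" by (simp add: \<delta>_def)
  then obtain k where k: "1 / a m < real k * (1 / C - \<delta>)"
    using ex_less_of_nat_mult[of "1 / C - \<delta>" "1 / a m"] by auto
  have "real k * a (m + k) \<le> real (m + k + 1) * a (m + k)"
    using pos[of "m + k"] by (intro mult_right_mono) auto
  also note decay
  finally have "real k / C \<le> 1 / a (m + k)"
    using pos[of "m + k"] C_pos by (simp add: field_simps)
  with k reciprocal_le_linear[of m k] show False
    by (simp add: \<delta>_def algebra_simps)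
qed

lemma strict_decreasing: "a (Suc n) < a n"
proof -
  have "0 < 1 / a (Suc n) - 1 / a n"
    using reciprocal_increment_ge[of n] C_pos by (smt (verit) zero_less_divide_1_iff)
  then show ?thesis
    using pos[of n] pos[of "Suc n"] by (simp add: field_simps)
qed

lemma gap_ratio_0: "2 \<le> gap_ratio 0"
  using strict_decreasing[of 0] initial by (simp add: gap_ratio_def field_simps)

text \<open>
  For \<open>p = a\<^sub>n\<close>, \<open>q = a\<^sub>n\<^sub>+\<^sub>1\<close>, \<open>r = a\<^sub>n\<^sub>+\<^sub>2\<close>, both this inequality and the concavity of the
  reciprocals are equivalent to \<open>q (p + r) \<le> 2 p r\<close>.
\<close>
lemma gap_ratio_Suc: "gap_ratio n + 1 \<le> gap_ratio (Suc n)"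
proof -
  define p q r where "p = a n" and "q = a (Suc n)" and "r = a (Suc (Suc n))"
  have order: "0 < r" "r < q" "q < p"
    using strict_decreasing pos by (auto simp: p_def q_def r_def)
  have "1 / p + 1 / r \<le> 2 / q"
    using concave[of n] by (simp add: p_def q_def r_def)
  then have "q * (p + r) \<le> 2 * p * r"
    using order by (simp add: field_simps)
  then have "p / (p - q) + 1 \<le> q / (q - r)"
    using order by (simp add: field_simps)
  then show ?thesis by (simp add: gap_ratio_def p_def q_def r_def)
qed

lemma gap_ratio_pos: "0 < gap_ratio n"
  using strict_decreasing[of n] pos[of n] by (simp add: gap_ratio_def)

text \<open>
  The ratio equals \<open>(1 / a\<^sub>n\<^sub>+\<^sub>1) / (1 / a\<^sub>n\<^sub>+\<^sub>1 - 1 / a\<^sub>n)\<close>. Its denominator is bounded below, and its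
  numerator grows at most linearly by concavity.
\<close>
lemma gap_ratio_linear_bound: "gap_ratio n \<le> 2 * C / a 0 * real (n + 1)"
proof -
  have "a n - a (Suc n) = (1 / a (Suc n) - 1 / a n) * (a n * a (Suc n))"
    using pos[of n] pos[of "Suc n"] by (simp add: field_simps)
  then have "gap_ratio n = 1 / a (Suc n) / (1 / a (Suc n) - 1 / a n)"
    unfolding gap_ratio_def using pos[of n] pos[of "Suc n"] by simp
  also have "\<dots> \<le> 1 / a (Suc n) / (1 / C)"
  proof (rule divide_left_mono[OF reciprocal_increment_ge])
    have "0 < 1 / C" using C_pos by simp
    with reciprocal_increment_ge[of n] show "0 < (1 / a (Suc n) - 1 / a n) * (1 / C)"
      by (intro mult_pos_pos) linarith+
  qed (use pos[of "Suc n"] in simp)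
  also have "\<dots> = C * (1 / a (Suc n))"
    by simp
  also have "1 / a (Suc n) \<le> 2 / a 0 * real (n + 1)"
  proof -
    have "1 / a 1 - 1 / a 0 \<le> 1 / a 0"
      using initial pos[of 0] pos[of 1] by (simp add: field_simps)
    then have "real (Suc n) * (1 / a 1 - 1 / a 0) \<le> real (Suc n) * (1 / a 0)"
      by (intro mult_left_mono) auto
    moreover have "1 / a 0 \<le> real (Suc n) * (1 / a 0)"
      using pos[of 0] by (simp add: field_simps)
    ultimately show ?thesis
      using reciprocal_le_linear[of 0 "Suc n"] by (simp add: field_simps)
  qed
  finally show ?thesis
    using C_pos by (simp add: mult_left_mono algebra_simps)
qed

text \<open>
  The main estimate. The adjoint is summed one step further than \<open>M\<close> because the entry \<open>h\<^sub>k\<^sub>+\<^sub>1\<close> is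
  paired with \<open>y\<^sub>k\<close>. The leftover \<open>h\<^sub>0 = T\<^sub>0\<close> is why the first ratio has to be at least \<open>2\<close>: one unit
  pays for \<open>h\<^sub>0\<close> and one for the term \<open>- |T\<^sub>0|\<^sup>2\<close>.
\<close>
lemma sum_M_minus_sum_adj_ge:
  assumes f: "f \<in> ell2"
  shows "- (gap_ratio N * (cmod (M_adj f (Suc (Suc N)) + M f (Suc N)))\<^sup>2)
    \<le> (\<Sum>n\<le>N. (cmod (M f n))\<^sup>2) - (\<Sum>n\<le>Suc N. (cmod (M_adj f n))\<^sup>2)"
proof -
  define T where "T k = M_adj f (Suc k) + M f k" for k
  have T_0: "M_adj f 0 = T 0"
    by (subst M_adj_step[OF f]) (simp add: T_def M_def)
  have T_step: "M f k = of_real (gap_ratio k) * (T k - T (Suc k))" for k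
  proof -
    have "T k - T (Suc k) = of_real (a k - a (Suc k)) * (\<Sum>j\<le>k. f j)"
      unfolding T_def by (subst M_adj_step[OF f, of "Suc k"]) (simp add: M_def algebra_simps)
    moreover have "gap_ratio k * (a k - a (Suc k)) = a k"
      using strict_decreasing[of k] by (simp add: gap_ratio_def)
    ultimately show ?thesis
      by (simp add: M_def del: of_real_diff flip: mult.assoc of_real_mult)
  qed
  have local: "gap_ratio k * ((cmod (T k))\<^sup>2 - (cmod (T (Suc k)))\<^sup>2) - (cmod (T k))\<^sup>2
      \<le> (cmod (M f k))\<^sup>2 - (cmod (M_adj f (Suc k)))\<^sup>2" for k
  proof -
    have adj: "M_adj f (Suc k) = T k - M f k"
      by (simp add: T_def)
    have "0 \<le> gap_ratio k * (cmod (T k - T (Suc k)))\<^sup>2"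
      using gap_ratio_pos[of k] by simp
    then show ?thesis
      unfolding adj T_step cmod_power2 by (simp add: algebra_simps power2_eq_square)
  qed
  have "- (gap_ratio N * (cmod (T (Suc N)))\<^sup>2)
      \<le> (\<Sum>n\<le>N. (cmod (M f n))\<^sup>2) - (\<Sum>n\<le>Suc N. (cmod (M_adj f n))\<^sup>2)"
  proof (induction N)
    case 0
    have "2 * (cmod (T 0))\<^sup>2 \<le> gap_ratio 0 * (cmod (T 0))\<^sup>2"
      using gap_ratio_0 by (intro mult_right_mono) auto
    then show ?case
      using local[of 0] by (simp add: T_0 algebra_simps)
  next
    case (Suc N)
    have "(gap_ratio N + 1) * (cmod (T (Suc N)))\<^sup>2 \<le> gap_ratio (Suc N) * (cmod (T (Suc N)))\<^sup>2"
      using gap_ratio_Suc[of N] by (intro mult_right_mono) auto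
    then show ?case
      using Suc local[of "Suc N"] by (simp add: algebra_simps)
  qed
  then show ?thesis by (simp add: T_def)
qed

theorem hyponormal_M: "hyponormal_ell2 M"
proof (rule hyponormal_M_I)
  fix f assume f: "f \<in> ell2"
  define D where "D = 2 * C / a 0"
  have D: "0 \<le> D" "\<And>n. gap_ratio n \<le> D * real (n + 1)"
    using gap_ratio_linear_bound C_pos pos[of 0] by (auto simp: D_def)
  have sM: "summable (\<lambda>n. (cmod (M f n))\<^sup>2)" and sA: "summable (\<lambda>n. (cmod (M_adj f n))\<^sup>2)"
    using M_ell2[OF f] M_adj_ell2[OF f] by (auto simp: ell2_def)
  define x where "x N = 2 * D * ((cmod (M_adj f (Suc (Suc N))))\<^sup>2 + (cmod (M f (Suc N)))\<^sup>2)" for N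
  have "0 \<le> (\<Sum>n. (cmod (M f n))\<^sup>2) - (\<Sum>n. (cmod (M_adj f n))\<^sup>2)"
  proof (rule limit_nonneg_of_summable_bound)
    show "(\<lambda>N. (\<Sum>n\<le>N. (cmod (M f n))\<^sup>2) - (\<Sum>n\<le>Suc N. (cmod (M_adj f n))\<^sup>2))
        \<longlonglongrightarrow> (\<Sum>n. (cmod (M f n))\<^sup>2) - (\<Sum>n. (cmod (M_adj f n))\<^sup>2)"
      by (intro tendsto_diff summable_LIMSEQ' sM LIMSEQ_Suc[OF summable_LIMSEQ'[OF sA]])
    show "summable x"
      unfolding x_def using sM sA
      by (intro summable_mult summable_add)
        (simp_all add: summable_Suc_iff[of "\<lambda>n. (cmod (M f n))\<^sup>2"]
          summable_Suc_iff[of "\<lambda>n. (cmod (M_adj f (Suc n)))\<^sup>2"]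
          summable_Suc_iff[of "\<lambda>n. (cmod (M_adj f n))\<^sup>2"])
    fix N
    define u v where "u = M_adj f (Suc (Suc N))" and "v = M f (Suc N)"
    have "(cmod (u + v))\<^sup>2 \<le> (cmod u + cmod v)\<^sup>2"
      by (intro power_mono norm_triangle_ineq) auto
    also have "\<dots> \<le> 2 * ((cmod u)\<^sup>2 + (cmod v)\<^sup>2)"
      using sum_squares_bound[of "cmod u" "cmod v"] by (simp add: power2_sum)
    finally have "gap_ratio N * (cmod (u + v))\<^sup>2
        \<le> (D * real (N + 1)) * (2 * ((cmod u)\<^sup>2 + (cmod v)\<^sup>2))"
      using D gap_ratio_pos[of N] by (intro mult_mono) auto
    also have "\<dots> = real (N + 1) * x N"
      by (simp add: x_def u_def v_def)
    finally show "- (real (N + 1) * x N)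
        \<le> (\<Sum>n\<le>N. (cmod (M f n))\<^sup>2) - (\<Sum>n\<le>Suc N. (cmod (M_adj f n))\<^sup>2)"
      using sum_M_minus_sum_adj_ge[OF f, of N] by (simp add: u_def v_def)
  qed
  then show "(\<Sum>n. (cmod (M_adj f n))\<^sup>2) \<le> (\<Sum>n. (cmod (M f n))\<^sup>2)"
    by simp
qed

end

section \<open>Concavity of the reciprocal of the hyperbolic sine\<close>

text \<open>
  The difference of the two sides vanishes at \<open>0\<close> together with its first two derivatives
  \<open>3 (cosh s - 1) - s sinh s\<close> and \<open>2 sinh s - s cosh s\<close>, and its third derivative
  \<open>cosh s - s sinh s\<close> is nonnegative on \<open>[0, 1]\<close>. This inequality, at \<open>s = 2 / x\<close>, decides the sign
  of the second derivative of \<open>1 / sinh (1 / x)\<close>.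
\<close>
lemma hyperbolic_inequality:
  fixes s :: real
  assumes "0 \<le> s" "s \<le> 1"
  shows "s * (cosh s - 1) \<le> 4 * (sinh s - s)"
proof -
  have k2: "0 \<le> 2 * sinh x - x * cosh x" if x: "0 \<le> x" "x \<le> 1" for x :: real
  proof -
    have "2 * sinh 0 - 0 * cosh 0 \<le> 2 * sinh x - x * cosh x"
    proof (rule DERIV_nonneg_imp_nondecreasing[OF x(1)], intro exI conjI)
      fix t assume t: "0 \<le> t" "t \<le> x"
      have "t * sinh t \<le> 1 * cosh t"
        using t x sinh_le_cosh_real[of t] by (intro mult_mono) auto
      then show "0 \<le> cosh t - t * sinh t" by simp
    qed (auto intro!: derivative_eq_intros)
    then show ?thesis by simp
  qed
  have k1: "0 \<le> 3 * (cosh x - 1) - x * sinh x" if x: "0 \<le> x" "x \<le> 1" for x :: real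
  proof -
    have "3 * (cosh 0 - 1) - 0 * sinh 0 \<le> 3 * (cosh x - 1) - x * sinh x"
    proof (rule DERIV_nonneg_imp_nondecreasing[OF x(1)], intro exI conjI)
      fix t assume "0 \<le> t" "t \<le> x"
      then show "0 \<le> 2 * sinh t - t * cosh t" using k2[of t] x by simp
    qed (auto intro!: derivative_eq_intros)
    then show ?thesis by simp
  qed
  have "4 * (sinh 0 - 0) - 0 * (cosh 0 - 1) \<le> 4 * (sinh s - s) - s * (cosh s - 1)"
  proof (rule DERIV_nonneg_imp_nondecreasing[OF assms(1)], intro exI conjI)
    fix t assume "0 \<le> t" "t \<le> s"
    then show "0 \<le> 3 * (cosh t - 1) - t * sinh t" using k1[of t] assms by simp
  qed (auto intro!: derivative_eq_intros)
  then show ?thesis by simp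
qed

text \<open>
  With \<open>t = 1 / x\<close>, the sign of the second derivative is opposite to that of
  \<open>2 cosh t sinh t + t sinh\<^sup>2 t - 2 t cosh\<^sup>2 t = sinh (2 t) - 2 t - t (cosh (2 t) - 1) / 2\<close>.
  Near \<open>x = 0\<close> the function behaves like \<open>2 exp (- 1 / x)\<close> and is convex, so some lower bound on
  \<open>x\<close> is unavoidable.
\<close>
lemma concave_inverse_sinh_inverse:
  "concave_on {2..} (\<lambda>x::real. 1 / sinh (1 / x))"
proof (rule f''_le0_imp_concave)
  fix x :: real assume "x \<in> {2..}"
  then have x: "2 \<le> x" by simp
  define t where "t = 1 / x"
  have t: "0 < t" "t \<le> 1 / 2"
    using x by (auto simp: t_def field_simps)
  have sh: "sinh t > 0" using t by simp
  show "((\<lambda>x. 1 / sinh (1 / x)) has_real_derivative (1 / x)\<^sup>2 * cosh (1 / x) / (sinh (1 / x))\<^sup>2) (at x)"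
    using x sh unfolding t_def
    by (auto intro!: derivative_eq_intros simp: power2_eq_square field_simps)
  show "((\<lambda>x. (1 / x)\<^sup>2 * cosh (1 / x) / (sinh (1 / x))\<^sup>2) has_real_derivative
      - ((1 / x)^3 / (sinh (1 / x))^3 *
        (2 * cosh (1 / x) * sinh (1 / x) + (1 / x) * (sinh (1 / x))\<^sup>2 - 2 * (1 / x) * (cosh (1 / x))\<^sup>2))) (at x)"
    using x sh unfolding t_def
    by (auto intro!: derivative_eq_intros)
      (simp add: divide_simps, simp add: eval_nat_numeral algebra_simps)
  have "2 * t * (cosh (2 * t) - 1) \<le> 4 * (sinh (2 * t) - 2 * t)"
    using t by (intro hyperbolic_inequality) auto
  then have "0 \<le> 2 * cosh t * sinh t + t * (sinh t)\<^sup>2 - 2 * t * (cosh t)\<^sup>2"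
    unfolding sinh_double cosh_double cosh_square_eq by (simp add: algebra_simps)
  then show "- ((1 / x)^3 / (sinh (1 / x))^3 *
        (2 * cosh (1 / x) * sinh (1 / x) + (1 / x) * (sinh (1 / x))\<^sup>2 - 2 * (1 / x) * (cosh (1 / x))\<^sup>2)) \<le> 0"
    unfolding t_def[symmetric] using t sh by simp
qed simp

lemma sinh_le_quadratic:
  fixes t :: real
  assumes "0 \<le> t" "t \<le> 1"
  shows "sinh t \<le> t + t\<^sup>2 / 2"
  using exp_bound[OF assms] exp_ge_add_one_self[of "- t"] by (simp add: sinh_field_def)

lemma inverse_sinh_second_difference:
  "1 / sinh (1 / (real n + 2)) + 1 / sinh (1 / (real n + 4)) \<le> 2 / sinh (1 / (real n + 3))"
proof -
  have "(1 - 1/2) * (1 / sinh (1 / (real n + 2))) + 1/2 * (1 / sinh (1 / (real n + 4)))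
      \<le> 1 / sinh (1 / ((1 - 1/2) *\<^sub>R (real n + 2) + (1/2) *\<^sub>R (real n + 4)))"
    by (rule concave_onD[OF concave_inverse_sinh_inverse]) auto
  also have "(1 - 1/2) *\<^sub>R (real n + 2) + (1/2) *\<^sub>R (real n + 4) = real n + 3"
    by (simp add: field_simps)
  finally show ?thesis by simp
qed

theorem proposition4:
  fixes a :: "nat \<Rightarrow> complex"
  assumes "\<And>n. a n = complex_of_real (sinh (1 / (real n + 2)))"
  shows "hyponormal_ell2 (matrix_action (terraced_matrix a))"
proof -
  define r where "r n = sinh (1 / (real n + 2))" for n
  interpret concave_terraced r 2
  proof
    fix n
    have t: "1 / (real n + 2) \<le> 1" "0 \<le> 1 / (real n + 2)" by auto
    then have "(1 / (real n + 2))\<^sup>2 \<le> 1 / (real n + 2)"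
      unfolding power2_eq_square by (rule mult_left_le)
    with sinh_le_quadratic[OF t(2,1)] t(2) have "r n \<le> 2 * (1 / (real n + 2))"
      unfolding r_def by linarith
    moreover have "0 \<le> r n"
      by (simp add: r_def)
    ultimately show "real (n + 1) * r n \<le> 2"
      by (simp add: field_simps)
    show "1 / r n + 1 / r (n + 2) \<le> 2 / r (n + 1)"
      using inverse_sinh_second_difference[of n] by (simp add: r_def add.commute add.left_commute)
    \<comment> \<open>\<open>sinh (1 / 2) \<le> 5 / 8\<close>, whereas \<open>2 sinh (1 / 3) \<ge> 2 / 3\<close>\<close>
    show "r 0 \<le> 2 * r 1"
      using sinh_le_quadratic[of "1/2"] real_le_x_sinh[of "1/3"]
      by (simp add: r_def sinh_field_def[of "1/3"] exp_minus power2_eq_square)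
  qed (simp_all add: r_def)
  have "matrix_action (terraced_matrix a) = M"
    by (simp add: fun_eq_iff matrix_action_terraced M_def r_def assms)
  then show ?thesis
    using hyponormal_M by simp
qed

end
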